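(* Let $(\mathfrak g,\cdot,\ast)$ be a compatible pre-Lie algebra over a field $\mathbb K$, with $\pi_1(x,y)=x\cdot y$ and $\pi_2(x,y)=x\ast y$. For $n\ge1$ let $\mathfrak C^n(\mathfrak g;\mathfrak g)$ be the direct sum of $n$ copies of $C^n(\mathfrak g;\mathfrak g)=\mathrm{Hom}(\wedge^{n-1}\mathfrak g\otimes\mathfrak g,\mathfrak g)$, and define $\delta:\mathfrak C^n(\mathfrak g;\mathfrak g)\to\mathfrak C^{n+1}(\mathfrak g;\mathfrak g)$ by $\delta f=(\delta_{\pi_1}f,\delta_{\pi_2}f)$ for $n=1$, and for $n\ge2$ $$\delta(f_1,\dots,f_n)=(\delta_{\pi_1}f_1,\ \delta_{\pi_2}f_1+\delta_{\pi_1}f_2,\ \dots,\ \delta_{\pi_2}f_{i-1}+\delta_{\pi_1}f_i,\ \dots,\ \delta_{\pi_2}f_{n-1}+\delta_{\pi_1}f_n,\ \delta_{\pi_2}f_n),$$ where the $i$-th entry is $\delta_{\pi_2}f_{i-1}+\delta_{\pi_1}f_i$ for $2\le i\le n$. Then $\delta\circ\delta=0$.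
   Context: Pre-Lie algebra: a vector space $\mathfrak g$ with a bilinear product $\cdot$ satisfying $(x\cdot y)\cdot z-x\cdot(y\cdot z)=(y\cdot x)\cdot z-y\cdot(x\cdot z)$ for all $x,y,z$. Compatible pre-Lie algebra: a triple $(\mathfrak g,\cdot,\ast)$ where $\cdot$ and $\ast$ are pre-Lie products on $\mathfrak g$ such that for all $x,y,z\in\mathfrak g$: $(x\ast y)\cdot z+(x\cdot y)\ast z-x\cdot(y\ast z)-x\ast(y\cdot z)-(y\ast x)\cdot z-(y\cdot x)\ast z+y\cdot(x\ast z)+y\ast(x\cdot z)=0$. For a pre-Lie product $\pi$ on $\mathfrak g$, the operator $\delta_\pi:C^n(\mathfrak g;\mathfrak g)\to C^{n+1}(\mathfrak g;\mathfrak g)$ is the usual pre-Lie coboundary with coefficients in the regular representation; writing $[x,y]_\pi=\pi(x,y)-\pi(y,x)$, explicitly $$(\delta_\pi f)(x_1,\dots,x_{n+1})=\sum_{i=1}^n(-1)^{i+1}\pi(x_i,f(x_1,\dots,\hat{x_i},\dots,x_{n+1}))+\sum_{i=1}^n(-1)^{i+1}\pi(f(x_1,\dots,\hat{x_i},\dots,x_n,x_i),x_{n+1})$$ $$-\sum_{i=1}^n(-1)^{i+1}f(x_1,\dots,\hat{x_i},\dots,x_n,\pi(x_i,x_{n+1}))+\sum_{1\le i<j\le n}(-1)^{i+j}f([x_i,x_j]_\pi,x_1,\dots,\hat{x_i},\dots,\hat{x_j},\dots,x_{n+1}).$$ Equivalently $\delta_\pi f=(-1)^{n-1}[\pi,f]^{MN}$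 with $[\cdot,\cdot]^{MN}$ the Matsushima-Nijenhuis graded Lie bracket: $[P,Q]^{MN}=P\circ Q-(-1)^{pq}Q\circ P$ for $P\in C^{p+1}(\mathfrak g;\mathfrak g)$, $Q\in C^{q+1}(\mathfrak g;\mathfrak g)$, where $$(P\circ Q)(x_1,\dots,x_{p+q+1})=\sum_{\sigma\in\mathbb S_{(q,1,p-1)}}\mathrm{sgn}(\sigma)P(Q(x_{\sigma(1)},\dots,x_{\sigma(q+1)}),x_{\sigma(q+2)},\dots,x_{\sigma(p+q)},x_{p+q+1})$$ $$+(-1)^{pq}\sum_{\sigma\in\mathbb S_{(p,q)}}\mathrm{sgn}(\sigma)P(x_{\sigma(1)},\dots,x_{\sigma(p)},Q(x_{\sigma(p+1)},\dots,x_{\sigma(p+q)},x_{p+q+1})),$$ $\mathbb S_{(i_1,\dots,i_k)}$ denoting unshuffles (permutations increasing on each consecutive block of lengths $i_1,\dots,i_k$), the first sum being empty if $p=0$. *)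

theory Defs
  imports Complex_Main
begin

locale pre_lie_algebra = vector_space scale
  for scale :: "'k::field \<Rightarrow> 'v::ab_group_add \<Rightarrow> 'v" +
  fixes mult :: "'v \<Rightarrow> 'v \<Rightarrow> 'v"
  assumes linear_left: "Vector_Spaces.linear scale scale (\<lambda>x. mult x y)"
    and linear_right: "Vector_Spaces.linear scale scale (\<lambda>y. mult x y)"
    and left_symmetric:
      "mult (mult x y) z - mult x (mult y z) = mult (mult y x) z - mult y (mult x z)"

locale compatible_pre_lie_algebra =
  dot: pre_lie_algebra scale dot + ast: pre_lie_algebra scale ast
  for scale :: "'k::field \<Rightarrow> 'v::ab_group_add \<Rightarrow> 'v"
    and dot :: "'v \<Rightarrow> 'v \<Rightarrow> 'v"
    and ast :: "'v \<Rightarrow> 'v \<Rightarrow> 'v" +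
  assumes compatible:
    "dot (ast x y) z + ast (dot x y) z - dot x (ast y z) - ast x (dot y z)
      - dot (ast y x) z - ast (dot y x) z + dot y (ast x z) + ast y (dot x z) = 0"

(* An n-cochain, i.e. an element of Hom(Wedge^(n-1) g (x) g, g), is an n-linear map that is
   alternating in its first n - 1 arguments.  The arguments are passed as a list of length n; the
   value 0 on lists of any other length makes equality of cochains equality of functions.
   Alternating means vanishing on repeated arguments, as needed in characteristic 2. *)
definition cochains ::
    "('k::field \<Rightarrow> 'v::ab_group_add \<Rightarrow> 'v) \<Rightarrow> nat \<Rightarrow> ('v list \<Rightarrow> 'v) set" where
  "cochains scale n = {f.
     (\<forall>xs. length xs \<noteq> n \<longrightarrow> f xs = 0) \<and>
     (\<forall>xs i. length xs = n \<longrightarrow> i < n \<longrightarrow>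
        Vector_Spaces.linear scale scale (\<lambda>v. f (xs[i := v]))) \<and>
     (\<forall>xs i j. length xs = n \<longrightarrow> i < j \<longrightarrow> j + 1 < n \<longrightarrow> xs ! i = xs ! j \<longrightarrow> f xs = 0)}"

definition alt_sign :: "nat \<Rightarrow> 'v::ab_group_add \<Rightarrow> 'v" where
  "alt_sign k v = (if even k then v else - v)"

definition omit :: "nat \<Rightarrow> 'a list \<Rightarrow> 'a list" where
  "omit i xs = take i xs @ drop (Suc i) xs"

(* The pre-Lie coboundary with coefficients in the regular representation.  The degree n of f is
   recovered from the number n + 1 of arguments.  Indices are shifted to start at 0, so that
   x_1, ..., x_(n+1) are xs ! 0, ..., xs ! n, the sign (-1)^(i+1) becomes (-1)^i, and (-1)^(i+j) is
   unchanged.  In the double sum i < j, so omit i (omit j xs) drops the original entries i and j. *)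
definition coboundary ::
    "('v::ab_group_add \<Rightarrow> 'v \<Rightarrow> 'v) \<Rightarrow> ('v list \<Rightarrow> 'v) \<Rightarrow> 'v list \<Rightarrow> 'v" where
  "coboundary mult f xs = (let n = length xs - 1 in
       (\<Sum>i<n. alt_sign i (mult (xs ! i) (f (omit i xs))))
     + (\<Sum>i<n. alt_sign i (mult (f (omit i (butlast xs) @ [xs ! i])) (last xs)))
     - (\<Sum>i<n. alt_sign i (f (omit i (butlast xs) @ [mult (xs ! i) (last xs)])))
     + (\<Sum>j<n. \<Sum>i<j. alt_sign (i + j)
          (f ((mult (xs ! i) (xs ! j) - mult (xs ! j) (xs ! i)) # omit i (omit j xs)))))"

definition compatible_cochains ::
    "('k::field \<Rightarrow> 'v::ab_group_add \<Rightarrow> 'v) \<Rightarrow> nat \<Rightarrow> ('v list \<Rightarrow> 'v) list set" where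
  "compatible_cochains scale n = {F. length F = n \<and> set F \<subseteq> cochains scale n}"

(* F ! i is f_(i+1); for length F = 1 the middle part is empty. *)
definition compatible_coboundary ::
    "('v::ab_group_add \<Rightarrow> 'v \<Rightarrow> 'v) \<Rightarrow> ('v \<Rightarrow> 'v \<Rightarrow> 'v) \<Rightarrow>
     ('v list \<Rightarrow> 'v) list \<Rightarrow> ('v list \<Rightarrow> 'v) list" where
  "compatible_coboundary dot ast F =
     [coboundary dot (F ! 0)]
     @ map (\<lambda>i xs. coboundary ast (F ! (i - 1)) xs + coboundary dot (F ! i) xs) [1..<length F]
     @ [coboundary ast (F ! (length F - 1))]"

end

theory Submission
  imports Defs
begin

text \<open>A cochain \<open>f\<close> is an alternating form on the commutator Lie algebra with values in the linear
  endomorphisms, where \<open>x\<close> acts by \<open>(x\<phi>)(y) = x\<cdot>\<phi>(y) + \<phi>(x)\<cdot>y - \<phi>(x\<cdot>y)\<close>, and the pre-Lie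
  coboundary is the Chevalley-Eilenberg differential \<open>d\<close> of this module. Cartan's formula
  \<open>\<iota>\<^sub>x d = L\<^sub>x - d \<iota>\<^sub>x\<close> determines \<open>d\<close> recursively, and induction on the number of arguments gives
  \<open>[L\<^sub>x, L\<^sub>y] = L\<^sub>[\<^sub>x\<^sub>,\<^sub>y\<^sub>]\<close>, then \<open>L\<^sub>x d = d L\<^sub>x\<close>, then \<open>d d = 0\<close>. Compatibility says that the sum of the
  two products is again pre-Lie; since \<open>d\<close> is additive in the product, polarizing \<open>d d = 0\<close> shows that
  the two coboundaries anticommute, and the entries of \<open>\<delta>\<delta>F\<close> vanish.\<close>

section \<open>Lie derivative and differential\<close>

text \<open>The contraction \<open>\<iota>\<^sub>z f\<close> is \<open>\<lambda>ys. f (z # ys)\<close>. The last entry of the list is the argument of the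
  endomorphism; the values on \<open>[]\<close> are junk.\<close>

fun lie_der :: "('v::ab_group_add \<Rightarrow> 'v \<Rightarrow> 'v) \<Rightarrow> 'v \<Rightarrow> ('v list \<Rightarrow> 'v) \<Rightarrow> 'v list \<Rightarrow> 'v" where
  "lie_der m x f [] = 0"
| "lie_der m x f [y] = m x (f [y]) + m (f [x]) y - f [m x y]"
| "lie_der m x f (z # w # zs) =
     lie_der m x (\<lambda>ys. f (z # ys)) (w # zs) - f ((m x z - m z x) # w # zs)"

text \<open>A differential has at least one Lie algebra argument besides the argument of the
  endomorphism, hence the value 0 on singletons. There the sums of \<open>coboundary\<close> are
  empty as well.\<close>

fun cartan_diff :: "('v::ab_group_add \<Rightarrow> 'v \<Rightarrow> 'v) \<Rightarrow> ('v list \<Rightarrow> 'v) \<Rightarrow> 'v list \<Rightarrow> 'v" where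
  "cartan_diff m f [] = 0"
| "cartan_diff m f [y] = 0"
| "cartan_diff m f (x # y # ys) =
     lie_der m x f (y # ys) - cartan_diff m (\<lambda>zs. f (x # zs)) (y # ys)"

lemma lie_der_Cons:
  "zs \<noteq> [] \<Longrightarrow>
    lie_der m x f (z # zs) = lie_der m x (\<lambda>ys. f (z # ys)) zs - f ((m x z - m z x) # zs)"
  by (cases zs) auto

lemma cartan_diff_Cons:
  "xs \<noteq> [] \<Longrightarrow>
    cartan_diff m f (x # xs) = lie_der m x f xs - cartan_diff m (\<lambda>zs. f (x # zs)) xs"
  by (cases xs) auto

text \<open>The recursion never removes the last argument, so \<open>f\<close> is only evaluated on
  nonempty lists. Agreement there is all that \<open>lie_der_Cons\<close> and
  \<open>cartan_diff_Cons\<close> can supply when they are rewritten under a binder.\<close>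

lemma lie_der_cong:
  "(\<And>ys. ys \<noteq> [] \<Longrightarrow> f ys = g ys) \<Longrightarrow> lie_der m x f zs = lie_der m x g zs"
proof (induction zs arbitrary: f g rule: induct_list012)
  case (3 z w zs)
  have "lie_der m x (\<lambda>ys. f (z # ys)) (w # zs) = lie_der m x (\<lambda>ys. g (z # ys)) (w # zs)"
    by (rule 3(2)) (simp add: 3(3))
  then show ?case by (simp add: 3(3))
qed simp_all

lemma cartan_diff_cong:
  "(\<And>ys. ys \<noteq> [] \<Longrightarrow> f ys = g ys) \<Longrightarrow> cartan_diff m f zs = cartan_diff m g zs"
proof (induction zs arbitrary: f g rule: induct_list012)
  case (3 z w zs)
  have "cartan_diff m (\<lambda>ys. f (z # ys)) (w # zs) = cartan_diff m (\<lambda>ys. g (z # ys)) (w # zs)"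
    by (rule 3(2)) (simp add: 3(3))
  moreover have "lie_der m z f (w # zs) = lie_der m z g (w # zs)"
    by (rule lie_der_cong) (rule 3(3))
  ultimately show ?case by simp
qed simp_all

lemma omit_Cons: "omit 0 (x # xs) = xs" "omit (Suc i) (x # xs) = x # omit i xs"
  by (simp_all add: omit_def)

text \<open>No degree is fixed: the condition covers lists of every length, so contractions of a
  form stay in the class without degree bookkeeping in the inductions.\<close>

definition multilinear ::
    "('k::field \<Rightarrow> 'v::ab_group_add \<Rightarrow> 'v) \<Rightarrow> ('v list \<Rightarrow> 'v) \<Rightarrow> bool" where
  "multilinear scale f \<longleftrightarrow>
     (\<forall>as bs. Vector_Spaces.linear scale scale (\<lambda>v. f (as @ v # bs)))"

text \<open>Equality of adjacent arguments suffices, since for multilinear maps it gives antisymmetry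
  under adjacent swaps. The last argument never takes part, hence \<^prop>\<open>bs \<noteq> []\<close>.\<close>

definition alternating :: "('v list \<Rightarrow> 'v::ab_group_add) \<Rightarrow> bool" where
  "alternating f \<longleftrightarrow> (\<forall>as z bs. bs \<noteq> [] \<longrightarrow> f (as @ z # z # bs) = 0)"

lemma multilinear_Cons: "multilinear scale f \<Longrightarrow> multilinear scale (\<lambda>ys. f (z # ys))"
  unfolding multilinear_def append_Cons[symmetric] by blast

lemma alternating_Cons: "alternating f \<Longrightarrow> alternating (\<lambda>ys. f (z # ys))"
  unfolding alternating_def append_Cons[symmetric] by blast

lemma alternatingD: "alternating f \<Longrightarrow> bs \<noteq> [] \<Longrightarrow> f (as @ z # z # bs) = 0"
  unfolding alternating_def by blast

section \<open>Linear maps, the commutator bracket and swaps of arguments\<close>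

context pre_lie_algebra
begin

lemma linear_iff':
  "Vector_Spaces.linear scale scale g \<longleftrightarrow>
    (\<forall>x y. g (x + y) = g x + g y) \<and> (\<forall>c x. g (scale c x) = scale c (g x))"
  using Vector_Spaces.linear_iff vector_space_axioms by blast

lemma linear_diff:
  "Vector_Spaces.linear scale scale f \<Longrightarrow> Vector_Spaces.linear scale scale g \<Longrightarrow>
    Vector_Spaces.linear scale scale (\<lambda>v. f v - g v)"
  by (simp add: linear_iff' scale_right_diff_distrib)

lemma linear_add:
  "Vector_Spaces.linear scale scale f \<Longrightarrow> Vector_Spaces.linear scale scale g \<Longrightarrow>
    Vector_Spaces.linear scale scale (\<lambda>v. f v + g v)"
  by (simp add: linear_iff' scale_right_distrib)

lemma linear_zero: "Vector_Spaces.linear scale scale (\<lambda>v. 0)"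
  by (simp add: linear_iff')

lemma linear_comp:
  "Vector_Spaces.linear scale scale f \<Longrightarrow> Vector_Spaces.linear scale scale g \<Longrightarrow>
    Vector_Spaces.linear scale scale (\<lambda>v. f (g v))"
  by (simp add: linear_iff')

lemma mult_add_left: "mult (x + y) z = mult x z + mult y z"
  using linear_left[of z] by (simp add: linear_iff')

lemma mult_add_right: "mult z (x + y) = mult z x + mult z y"
  using linear_right[of z] by (simp add: linear_iff')

lemma mult_zero_left: "mult 0 z = 0"
  using mult_add_left[of 0 0 z] by simp

lemma mult_zero_right: "mult z 0 = 0"
  using mult_add_right[of z 0 0] by simp

lemma mult_diff_left: "mult (x - y) z = mult x z - mult y z"
  using mult_add_left[of "x - y" y z] by simp

lemma mult_diff_right: "mult z (x - y) = mult z x - mult z y"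
  using mult_add_right[of z "x - y" y] by simp

text \<open>The associator is symmetric in its first two arguments, and the Jacobi expression is a
  sum of three differences that this symmetry kills. The derivation form chosen here is the one that
  fits brackets acting on a head argument.\<close>

lemma jacobi:
  "mult x (mult y z - mult z y) - mult (mult y z - mult z y) x
    = (mult (mult x y - mult y x) z - mult z (mult x y - mult y x))
      + (mult y (mult x z - mult z x) - mult (mult x z - mult z x) y)"
  (is "?l = ?r")
proof -
  define assoc where "assoc x y z = mult (mult x y) z - mult x (mult y z)" for x y z
  have sym: "assoc x y z = assoc y x z" for x y z
    unfolding assoc_def by (rule left_symmetric)
  have "?l - ?r = (assoc y x z - assoc x y z) + (assoc z y x - assoc y z x)
      + (assoc x z y - assoc z x y)"
    unfolding assoc_def by (simp add: mult_diff_left mult_diff_right algebra_simps)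
  also have "\<dots> = 0"
    using sym[of y x z] sym[of z y x] sym[of x z y] by simp
  finally show ?thesis by simp
qed

lemma multilinearD:
  "multilinear scale f \<Longrightarrow> Vector_Spaces.linear scale scale (\<lambda>v. f (as @ v # bs))"
  unfolding multilinear_def by blast

lemma multilinear_head:
  "multilinear scale f \<Longrightarrow> Vector_Spaces.linear scale scale (\<lambda>v. f (v # bs))"
  using multilinearD[of f "[]"] by simp

lemma multilinear_plus:
  "multilinear scale f \<Longrightarrow> f (as @ (x + y) # bs) = f (as @ x # bs) + f (as @ y # bs)"
  using multilinearD[of f as bs] by (simp add: linear_iff')

lemma multilinear_plus_head:
  "multilinear scale f \<Longrightarrow> f ((x + y) # bs) = f (x # bs) + f (y # bs)"
  using multilinear_plus[of f "[]"] by simp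

lemma multilinear_diff_head:
  "multilinear scale f \<Longrightarrow> f ((x - y) # bs) = f (x # bs) - f (y # bs)"
  using multilinear_plus_head[of f "x - y" y bs] by simp

lemma multilinear_zero_head: "multilinear scale f \<Longrightarrow> f (0 # bs) = 0"
  using multilinear_plus_head[of f 0 0 bs] by simp

lemma alternating_swap:
  assumes "multilinear scale f" "alternating f" "bs \<noteq> []"
  shows "f (as @ u # v # bs) = - f (as @ v # u # bs)"
proof -
  have "0 = f (as @ (u + v) # (u + v) # bs)"
    by (simp add: alternatingD[OF assms(2,3)])
  also have "\<dots> = f (as @ u # v # bs) + f (as @ v # u # bs)"
    using multilinear_plus[OF assms(1), of "as @ [u]" u v bs]
      multilinear_plus[OF assms(1), of "as @ [v]" u v bs]
    unfolding multilinear_plus[OF assms(1), of as u v]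
    by (simp add: alternatingD[OF assms(2,3)])
  finally show ?thesis
    by (simp add: eq_neg_iff_add_eq_0)
qed

lemma alternating_swap_head:
  "multilinear scale f \<Longrightarrow> alternating f \<Longrightarrow> bs \<noteq> [] \<Longrightarrow> f (u # v # bs) = - f (v # u # bs)"
  by (rule alternating_swap[of f bs "[]", unfolded append_Nil])

text \<open>Swaps move the first \<open>z\<close> across \<open>cs\<close> until the two copies are
  adjacent. This recovers the condition on arbitrary positions used in
  \<open>cochains\<close>.\<close>

lemma alternating_apart:
  assumes "multilinear scale f" "alternating f" "bs \<noteq> []"
  shows "f (as @ z # cs @ z # bs) = 0"
proof (induction cs arbitrary: as)
  case Nil
  then show ?case by (simp add: alternatingD[OF assms(2,3)])
next
  case (Cons c cs)
  then show ?case
    using alternating_swap[OF assms(1,2), of "cs @ z # bs" as z c] Cons[of "as @ [c]"] by simp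
qed

section \<open>Closure of multilinear and alternating forms under the two operators\<close>

text \<open>Once the head argument has been contracted into the form, linearity in it becomes
  linearity in a parameter of the form; this version survives the recursion.\<close>

lemma lie_der_linear_family:
  "(\<And>ys. Vector_Spaces.linear scale scale (\<lambda>v. F v ys)) \<Longrightarrow>
    Vector_Spaces.linear scale scale (\<lambda>v. lie_der mult x (F v) zs)"
proof (induction zs arbitrary: F rule: induct_list012)
  case (2 y)
  show ?case
    by (simp, intro linear_diff linear_add linear_comp[OF linear_right, of "\<lambda>v. F v [y]"]
      linear_comp[OF linear_left, of "\<lambda>v. F v [x]"] 2)
next
  case (3 z w zs)
  show ?case
    by (simp, intro linear_diff 3)
qed (simp add: linear_zero)

lemma cartan_diff_linear_family:
  "(\<And>ys. Vector_Spaces.linear scale scale (\<lambda>v. F v ys)) \<Longrightarrow>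
    Vector_Spaces.linear scale scale (\<lambda>v. cartan_diff mult (F v) zs)"
proof (induction zs arbitrary: F rule: induct_list012)
  case (3 z w zs)
  show ?case
    by (simp del: lie_der.simps, intro linear_diff lie_der_linear_family 3)
qed (simp_all add: linear_zero)

text \<open>\<open>cartan_diff\<close> turns its head argument into the direction of a Lie
  derivative, so its linearity there needs linearity in the direction.\<close>

lemma lie_der_linear:
  "multilinear scale f \<Longrightarrow> Vector_Spaces.linear scale scale (\<lambda>x. lie_der mult x f zs)"
proof (induction zs arbitrary: f rule: induct_list012)
  case (2 y)
  note h = multilinear_head[OF 2, of "[]"]
  show ?case
    by (simp, intro linear_diff linear_add linear_left linear_comp[OF linear_left h]
      linear_comp[OF h linear_left])
next
  case (3 z w zs)
  show ?case
    by (simp, intro linear_diff 3 multilinear_Cons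
      linear_comp[OF multilinear_head[OF 3(3), of "w # zs"]] linear_left linear_right)
qed (simp add: linear_zero)

lemma multilinear_lie_der:
  assumes "multilinear scale f" shows "multilinear scale (lie_der mult x f)"
  unfolding multilinear_def
proof (intro allI)
  fix as bs
  show "Vector_Spaces.linear scale scale (\<lambda>v. lie_der mult x f (as @ v # bs))"
    using assms
  proof (induction as arbitrary: f)
    case Nil
    show ?case
    proof (cases bs)
      case Nil
      note h = multilinear_head[OF \<open>multilinear scale f\<close>, of "[]"]
      show ?thesis
        by (simp add: Nil, intro linear_diff linear_add linear_right
          linear_comp[OF linear_right h] linear_comp[OF h linear_right])
    next
      case (Cons b bs')
      then have "bs \<noteq> []" by simp
      show ?thesis
        by (simp add: lie_der_Cons[OF \<open>bs \<noteq> []\<close>],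
          intro linear_diff lie_der_linear_family multilinear_head Nil
            linear_comp[OF multilinear_head[OF Nil, of bs]] linear_left linear_right)
    qed
  next
    case (Cons a as)
    have "Vector_Spaces.linear scale scale
        (\<lambda>v. lie_der mult x (\<lambda>ys. f (a # ys)) (as @ v # bs)
          - f (((mult x a - mult a x) # as) @ v # bs))"
      by (intro linear_diff Cons multilinear_Cons multilinearD[OF Cons(2)])
    then show ?case
      by (simp add: lie_der_Cons)
  qed
qed

lemma multilinear_cartan_diff:
  assumes "multilinear scale f" shows "multilinear scale (cartan_diff mult f)"
  unfolding multilinear_def
proof (intro allI)
  fix as bs
  show "Vector_Spaces.linear scale scale (\<lambda>v. cartan_diff mult f (as @ v # bs))"
    using assms
  proof (induction as arbitrary: f)
    case Nil
    show ?case
    proof (cases bs)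
      case (Cons b bs')
      then have "bs \<noteq> []" by simp
      show ?thesis
        by (simp add: cartan_diff_Cons[OF \<open>bs \<noteq> []\<close>],
          intro linear_diff cartan_diff_linear_family multilinear_head Nil lie_der_linear)
    qed (simp add: linear_zero)
  next
    case (Cons a as)
    show ?case
      by (simp add: cartan_diff_Cons, intro linear_diff Cons multilinear_Cons
        multilinearD[OF multilinear_lie_der[OF Cons(2)]])
  qed
qed

lemma lie_der_zero: "(\<And>ys. ys \<noteq> [] \<Longrightarrow> f ys = 0) \<Longrightarrow> lie_der mult x f zs = 0"
  by (induction zs arbitrary: f rule: induct_list012)
    (simp_all add: mult_zero_left mult_zero_right)

lemma cartan_diff_zero: "(\<And>ys. ys \<noteq> [] \<Longrightarrow> f ys = 0) \<Longrightarrow> cartan_diff mult f zs = 0"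
  by (induction zs arbitrary: f rule: induct_list012)
    (simp_all add: lie_der_zero del: lie_der.simps)

lemma lie_der_add:
  "lie_der mult x (\<lambda>ys. f ys + g ys) zs = lie_der mult x f zs + lie_der mult x g zs"
  by (induction zs arbitrary: f g rule: induct_list012)
    (simp_all add: mult_add_left mult_add_right)

lemma lie_der_diff:
  "lie_der mult x (\<lambda>ys. f ys - g ys) zs = lie_der mult x f zs - lie_der mult x g zs"
  using lie_der_add[of x "\<lambda>ys. f ys - g ys" g zs] by simp

lemma cartan_diff_add:
  "cartan_diff mult (\<lambda>ys. f ys + g ys) zs = cartan_diff mult f zs + cartan_diff mult g zs"
  by (induction zs arbitrary: f g rule: induct_list012)
    (simp_all add: lie_der_add del: lie_der.simps)

lemma cartan_diff_diff:
  "cartan_diff mult (\<lambda>ys. f ys - g ys) zs = cartan_diff mult f zs - cartan_diff mult g zs"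
  using cartan_diff_add[of "\<lambda>ys. f ys - g ys" g zs] by simp

lemma alternating_lie_der:
  assumes "multilinear scale f" "alternating f"
  shows "alternating (lie_der mult x f)"
  unfolding alternating_def
proof (intro allI impI)
  fix as z bs
  assume bs: "bs \<noteq> ([] :: 'v list)"
  show "lie_der mult x f (as @ z # z # bs) = 0"
    using assms
  proof (induction as arbitrary: f)
    case Nil
    have "lie_der mult x (\<lambda>ys. f (z # z # ys)) bs = 0"
      using alternatingD[OF Nil(2), of _ "[]"] by (intro lie_der_zero) simp
    \<comment> \<open>Two bracket terms remain, with \<open>mult x z - mult z x\<close> in the first
      and in the second place next to \<open>z\<close>; they cancel by antisymmetry.\<close>
    then show ?case
      using alternating_swap_head[OF Nil bs, of "mult x z - mult z x" z] by (simp add: lie_der_Cons bs)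
  next
    case (Cons a as)
    have "lie_der mult x (\<lambda>ys. f (a # ys)) (as @ z # z # bs) = 0"
      by (intro Cons multilinear_Cons alternating_Cons)
    then show ?case
      using alternatingD[OF Cons(3) bs, of "_ # as"] by (simp add: lie_der_Cons)
  qed
qed

lemma alternating_cartan_diff:
  assumes "multilinear scale f" "alternating f"
  shows "alternating (cartan_diff mult f)"
  unfolding alternating_def
proof (intro allI impI)
  fix as z bs
  assume bs: "bs \<noteq> ([] :: 'v list)"
  show "cartan_diff mult f (as @ z # z # bs) = 0"
    using assms
  proof (induction as arbitrary: f)
    case Nil
    have "cartan_diff mult (\<lambda>ys. f (z # z # ys)) bs = 0"
      using alternatingD[OF Nil(2), of _ "[]"] by (intro cartan_diff_zero) simp
    \<comment> \<open>Both recursion steps produce the Lie derivative along \<open>z\<close> of the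
      form contracted with \<open>z\<close>, with opposite signs; the bracket of \<open>z\<close>
      with itself is 0.\<close>
    then show ?case
      by (simp add: lie_der_Cons cartan_diff_Cons bs multilinear_zero_head[OF Nil(1)])
  next
    case (Cons a as)
    have "cartan_diff mult (\<lambda>ys. f (a # ys)) (as @ z # z # bs) = 0"
      by (intro Cons multilinear_Cons alternating_Cons)
    then show ?case
      using alternatingD[OF alternating_lie_der[OF Cons(2,3)] bs]
      by (simp add: cartan_diff_Cons)
  qed
qed

section \<open>Cartan calculus: commutators of Lie derivatives and the square of the
  differential\<close>

text \<open>The base case says that the action on the linear endomorphisms is a representation.\<close>

lemma lie_der_commutator:
  assumes "multilinear scale f"
  shows "lie_der mult x (lie_der mult y f) zs - lie_der mult y (lie_der mult x f) zs
    = lie_der mult (mult x y - mult y x) f zs"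
  using assms
proof (induction zs arbitrary: f rule: induct_list012)
  case (2 z)
  note f = multilinear_plus_head[OF 2] multilinear_diff_head[OF 2]
  define assoc where "assoc x y z = mult (mult x y) z - mult x (mult y z)" for x y z
  have assoc: "assoc x y z - assoc y x z = 0" for x y z
    unfolding assoc_def left_symmetric[of x y z] by simp
  have "lie_der mult x (lie_der mult y f) [z] - lie_der mult y (lie_der mult x f) [z]
      - lie_der mult (mult x y - mult y x) f [z]
    = f [assoc x y z - assoc y x z] - (assoc x y (f [z]) - assoc y x (f [z]))
      - (assoc x (f [y]) z - assoc (f [y]) x z) + (assoc y (f [x]) z - assoc (f [x]) y z)"
    by (simp add: assoc_def f mult_add_left mult_add_right mult_diff_left mult_diff_right
        algebra_simps)
  also have "\<dots> = 0"
    by (simp only: assoc multilinear_zero_head[OF 2]) simp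
  finally show ?case by simp
next
  case (3 z w zs)
  define ws where "ws = w # zs"
  have ws: "ws \<noteq> []" by (simp add: ws_def)
  note IH = 3(2)[folded ws_def]
  \<comment> \<open>The two middle terms are interchanged when \<open>x\<close> and \<open>y\<close>
    are, so they cancel in the commutator. The double brackets that are left combine by
    \<open>jacobi\<close>.\<close>
  have step: "lie_der mult x (lie_der mult y f) (z # ws)
      = lie_der mult x (lie_der mult y (\<lambda>ys. f (z # ys))) ws
        - lie_der mult x (\<lambda>ys. f ((mult y z - mult z y) # ys)) ws
        - lie_der mult y (\<lambda>ys. f ((mult x z - mult z x) # ys)) ws
        + f ((mult y (mult x z - mult z x) - mult (mult x z - mult z x) y) # ws)" for x y
  proof -
    have "lie_der mult x (\<lambda>ys. lie_der mult y f (z # ys)) ws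
        = lie_der mult x (\<lambda>ys. lie_der mult y (\<lambda>ys. f (z # ys)) ys
            - f ((mult y z - mult z y) # ys)) ws"
      by (rule lie_der_cong) (simp add: lie_der_Cons)
    then show ?thesis
      by (simp add: lie_der_Cons[OF ws] lie_der_diff)
  qed
  show ?case
    unfolding ws_def[symmetric]
    using IH[OF multilinear_Cons[OF 3(3)], of z]
    unfolding step
    unfolding lie_der_Cons[OF ws] jacobi[of x y z] multilinear_plus_head[OF 3(3)]
    by (simp add: algebra_simps)
qed simp

text \<open>After contraction with \<open>z\<close>, the terms containing the differential of
  \<open>?h\<close> agree on both sides. The rest is the induction hypothesis for \<open>?g\<close>
  together with the commutator of the Lie derivatives along \<open>x\<close> and
  \<open>z\<close>.\<close>

lemma lie_der_cartan_diff:
  assumes "multilinear scale f"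
  shows "lie_der mult x (cartan_diff mult f) zs = cartan_diff mult (lie_der mult x f) zs"
  using assms
proof (induction zs arbitrary: f rule: induct_list012)
  case (2 z)
  then show ?case by (simp add: mult_zero_left mult_zero_right)
next
  case (3 z w zs)
  define ws where "ws = w # zs"
  have ws: "ws \<noteq> []" by (simp add: ws_def)
  let ?g = "\<lambda>ys. f (z # ys)"
  let ?w = "mult x z - mult z x"
  let ?h = "\<lambda>ys. f (?w # ys)"
  have "lie_der mult x (\<lambda>ys. cartan_diff mult f (z # ys)) ws
      = lie_der mult x (\<lambda>ys. lie_der mult z f ys - cartan_diff mult ?g ys) ws"
    by (rule lie_der_cong) (rule cartan_diff_Cons)
  then have 1: "lie_der mult x (cartan_diff mult f) (z # ws)
      = lie_der mult x (lie_der mult z f) ws - lie_der mult x (cartan_diff mult ?g) ws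
        - (lie_der mult ?w f ws - cartan_diff mult ?h ws)"
    by (simp only: lie_der_Cons[OF ws] lie_der_diff cartan_diff_Cons[OF ws])
  have "cartan_diff mult (\<lambda>ys. lie_der mult x f (z # ys)) ws
      = cartan_diff mult (\<lambda>ys. lie_der mult x ?g ys - ?h ys) ws"
    by (rule cartan_diff_cong) (rule lie_der_Cons)
  then have 2: "cartan_diff mult (lie_der mult x f) (z # ws)
      = lie_der mult z (lie_der mult x f) ws
        - (cartan_diff mult (lie_der mult x ?g) ws - cartan_diff mult ?h ws)"
    by (simp only: cartan_diff_Cons[OF ws] cartan_diff_diff)
  show ?case
    unfolding ws_def[symmetric] 1 2 lie_der_commutator[OF 3(3), of x z ws, symmetric]
      3(2)[OF multilinear_Cons[OF 3(3)], of z, folded ws_def]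
    by simp
qed simp

lemma cartan_diff_cartan_diff:
  "multilinear scale f \<Longrightarrow> cartan_diff mult (cartan_diff mult f) zs = 0"
proof (induction zs arbitrary: f rule: induct_list012)
  case (3 z w zs)
  define ws where "ws = w # zs"
  have ws: "ws \<noteq> []" by (simp add: ws_def)
  have "cartan_diff mult (\<lambda>ys. cartan_diff mult f (z # ys)) ws
      = cartan_diff mult (\<lambda>ys. lie_der mult z f ys - cartan_diff mult (\<lambda>ys. f (z # ys)) ys) ws"
    by (rule cartan_diff_cong) (rule cartan_diff_Cons)
  also have "\<dots> = cartan_diff mult (lie_der mult z f) ws"
    unfolding cartan_diff_diff
    using 3(2)[OF multilinear_Cons[OF 3(3)], of z] by (simp add: ws_def del: cartan_diff.simps)
  finally show ?case
    unfolding ws_def[symmetric] cartan_diff_Cons[OF ws] lie_der_cartan_diff[OF 3(3)] by simp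
qed simp_all

section \<open>The coboundary as a Chevalley-Eilenberg differential\<close>

text \<open>The recursion replaces an argument in place, while \<open>coboundary\<close> puts the
  bracket at the front. Moving it there past \<open>j\<close> arguments produces
  \<open>alt_sign j\<close>; the three terms outside the sum are the action on the
  endomorphism.\<close>

lemma lie_der_eq_sum:
  assumes "multilinear scale f" "alternating f" "zs \<noteq> []"
  shows "lie_der mult x f zs
    = mult x (f zs) + mult (f (butlast zs @ [x])) (last zs) - f (butlast zs @ [mult x (last zs)])
      - (\<Sum>j<length zs - 1.
          alt_sign j (f ((mult x (zs ! j) - mult (zs ! j) x) # omit j zs)))"
  using assms
proof (induction zs arbitrary: f rule: induct_list012)
  case (3 z w zs)
  define ws where "ws = w # zs"
  have ws: "ws \<noteq> []" by (simp add: ws_def)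
  have len: "length (z # ws) - 1 = Suc (length ws - 1)" using ws by (cases ws) auto
  let ?b = "\<lambda>j. mult x (ws ! j) - mult (ws ! j) x"
  have swap: "alt_sign (Suc j) (f (?b j # z # omit j ws)) = alt_sign j (f (z # ?b j # omit j ws))"
    if "j < length ws - 1" for j
  proof -
    have "length (omit j ws) = length ws - 1" using that by (simp add: omit_def)
    then have "omit j ws \<noteq> []" using that by auto
    from alternating_swap_head[OF 3(3,4) this, of "?b j" z] show ?thesis
      by (simp add: alt_sign_def)
  qed
  have "(\<Sum>j<length (z # ws) - 1.
          alt_sign j (f ((mult x ((z # ws) ! j) - mult ((z # ws) ! j) x) # omit j (z # ws))))
      = f ((mult x z - mult z x) # ws)
        + (\<Sum>j<length ws - 1. alt_sign (Suc j) (f (?b j # z # omit j ws)))"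
    unfolding len sum.lessThan_Suc_shift by (simp add: omit_def alt_sign_def)
  also have "\<dots> = f ((mult x z - mult z x) # ws)
        + (\<Sum>j<length ws - 1. alt_sign j (f (z # ?b j # omit j ws)))"
    using swap by simp
  finally show ?case
    using 3(2)[OF multilinear_Cons[OF 3(3)] alternating_Cons[OF 3(4)], of z]
    unfolding ws_def[symmetric] by (simp add: ws lie_der_Cons algebra_simps)
qed (simp_all add: omit_def)

text \<open>This is Cartan's formula for the explicit sums. The terms with \<open>i = 0\<close> make
  up the Lie derivative. In the others, shifting indices flips the sign of the single sums; in the
  double sum two shifts preserve the sign, and the minus comes from swapping \<open>x\<close> with
  the bracket.\<close>

lemma coboundary_Cons:
  assumes "multilinear scale f" "alternating f" "zs \<noteq> []"
  shows "coboundary mult f (x # zs) = lie_der mult x f zs - coboundary mult (\<lambda>ys. f (x # ys)) zs"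
proof -
  define n where "n = length zs - 1"
  have len: "length (x # zs) - 1 = Suc n" using assms(3) by (cases zs) (auto simp: n_def)
  let ?b = "\<lambda>i j. mult (zs ! i) (zs ! j) - mult (zs ! j) (zs ! i)"
  have swap: "alt_sign (i + j) (f (?b i j # x # omit i (omit j zs)))
      = - alt_sign (i + j) (f (x # ?b i j # omit i (omit j zs)))"
    if "j < n" "i < j" for i j
  proof -
    have "length (omit i (omit j zs)) = length zs - 2"
      using that by (simp add: omit_def n_def)
    then have "omit i (omit j zs) \<noteq> []" using that by (auto simp: n_def)
    from alternating_swap_head[OF assms(1,2) this, of "?b i j" x] show ?thesis
      by (simp add: alt_sign_def)
  qed
  have alt_sign_Suc: "alt_sign (Suc i) v = - alt_sign i v" for i and v :: 'v
    by (simp add: alt_sign_def)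
  have double: "(\<Sum>j<Suc n. \<Sum>i<j. alt_sign (i + j)
        (f ((mult ((x # zs) ! i) ((x # zs) ! j) - mult ((x # zs) ! j) ((x # zs) ! i))
          # omit i (omit j (x # zs)))))
      = - (\<Sum>j<n. alt_sign j (f ((mult x (zs ! j) - mult (zs ! j) x) # omit j zs)))
        - (\<Sum>j<n. \<Sum>i<j. alt_sign (i + j) (f (x # ?b i j # omit i (omit j zs))))"
    unfolding sum.lessThan_Suc_shift
    using swap by (simp add: omit_Cons alt_sign_Suc sum.distrib sum_negf sum_subtractf)
  show ?thesis
    unfolding coboundary_def Let_def len double lie_der_eq_sum[OF assms] n_def[symmetric]
    unfolding sum.lessThan_Suc_shift
    using assms(3) by (simp add: omit_Cons alt_sign_Suc sum_negf alt_sign_def[of 0])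
qed

lemma coboundary_eq_cartan_diff:
  "multilinear scale f \<Longrightarrow> alternating f \<Longrightarrow> coboundary mult f zs = cartan_diff mult f zs"
proof (induction zs arbitrary: f rule: induct_list012)
  case (3 z w zs)
  then show ?case
    by (simp add: coboundary_Cons multilinear_Cons alternating_Cons del: lie_der.simps)
qed (simp_all add: coboundary_def)

section \<open>Cochains of a fixed degree\<close>

lemma lie_der_off_degree:
  "(\<And>ys. length ys \<noteq> n \<Longrightarrow> f ys = 0) \<Longrightarrow> length zs \<noteq> n \<Longrightarrow> lie_der mult x f zs = 0"
proof (induction zs arbitrary: f n rule: induct_list012)
  case (3 z w zs)
  show ?case
  proof (cases n)
    case 0
    then show ?thesis by (intro lie_der_zero 3(3)) auto
  next
    case (Suc k)
    then have "lie_der mult x (\<lambda>ys. f (z # ys)) (w # zs) = 0"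
      using 3(3,4) by (intro 3(2)[of k]) auto
    then show ?thesis using 3(3,4) by simp
  qed
qed (simp_all add: mult_zero_left mult_zero_right)

lemma cartan_diff_off_degree:
  "(\<And>ys. length ys \<noteq> n \<Longrightarrow> f ys = 0) \<Longrightarrow> length zs \<noteq> Suc n \<Longrightarrow> cartan_diff mult f zs = 0"
proof (induction zs arbitrary: f n rule: induct_list012)
  case (3 z w zs)
  show ?case
  proof (cases n)
    case 0
    then show ?thesis by (intro cartan_diff_zero 3(3)) auto
  next
    case (Suc k)
    then have "cartan_diff mult (\<lambda>ys. f (z # ys)) (w # zs) = 0"
      using 3(3,4) by (intro 3(2)[of k]) auto
    moreover have "lie_der mult z f (w # zs) = 0"
      using 3(3,4) by (intro lie_der_off_degree[of n]) auto
    ultimately show ?thesis by simp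
  qed
qed simp_all

text \<open>A cochain is 0 off its degree, so the conditions on all lengths add nothing there; this
  lets the degree-free results apply to cochains.\<close>

lemma cochains_iff:
  "f \<in> cochains scale n \<longleftrightarrow>
    multilinear scale f \<and> alternating f \<and> (\<forall>xs. length xs \<noteq> n \<longrightarrow> f xs = 0)"
proof (intro iffI conjI)
  assume "f \<in> cochains scale n"
  then have off: "length xs \<noteq> n \<Longrightarrow> f xs = 0"
    and lin: "length xs = n \<Longrightarrow> i < n \<Longrightarrow> Vector_Spaces.linear scale scale (\<lambda>v. f (xs[i := v]))"
    and alt: "length xs = n \<Longrightarrow> i < j \<Longrightarrow> j + 1 < n \<Longrightarrow> xs ! i = xs ! j \<Longrightarrow> f xs = 0" for xs i j
    by (auto simp: cochains_def)
  show "\<forall>xs. length xs \<noteq> n \<longrightarrow> f xs = 0" using off by blast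
  show "multilinear scale f"
    unfolding multilinear_def
  proof (intro allI)
    fix as bs
    show "Vector_Spaces.linear scale scale (\<lambda>v. f (as @ v # bs))"
    proof (cases "length as + length bs + 1 = n")
      case True
      \<comment> \<open>The entry \<open>0\<close> is a placeholder that the list update
        overwrites.\<close>
      then show ?thesis using lin[of "as @ 0 # bs" "length as"] by simp
    next
      case False
      then show ?thesis by (simp add: off linear_zero)
    qed
  qed
  show "alternating f"
    unfolding alternating_def
  proof (intro allI impI)
    fix as z bs
    assume "bs \<noteq> ([] :: 'v list)"
    then show "f (as @ z # z # bs) = 0"
      using off[of "as @ z # z # bs"] alt[of "as @ z # z # bs" "length as" "Suc (length as)"]
      by (cases "length (as @ z # z # bs) = n") (auto simp: nth_append)
  qed
next
  assume f: "multilinear scale f \<and> alternating f \<and> (\<forall>xs. length xs \<noteq> n \<longrightarrow> f xs = 0)"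
  have "Vector_Spaces.linear scale scale (\<lambda>v. f (xs[i := v]))" if "length xs = n" "i < n" for xs i
    using multilinearD[of f "take i xs" "drop (Suc i) xs"] f that
    by (simp add: upd_conv_take_nth_drop)
  moreover have "f xs = 0" if "length xs = n" "i < j" "j + 1 < n" "xs ! i = xs ! j" for xs i j
  proof -
    \<comment> \<open>The entries strictly between positions \<open>i\<close> and
      \<open>j\<close>.\<close>
    let ?cs = "take (j - Suc i) (drop (Suc i) xs)"
    have "drop (Suc i) xs = ?cs @ xs ! j # drop (Suc j) xs"
      using that id_take_nth_drop[of "j - Suc i" "drop (Suc i) xs"] by simp
    then have "xs = take i xs @ xs ! j # ?cs @ xs ! j # drop (Suc j) xs"
      using that id_take_nth_drop[of i xs] by simp
    then show ?thesis
      using alternating_apart[of f "drop (Suc j) xs" "take i xs" "xs ! j" ?cs] f that by simp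
  qed
  ultimately show "f \<in> cochains scale n" using f by (auto simp: cochains_def)
qed

lemma coboundary_cochain: "f \<in> cochains scale n \<Longrightarrow> coboundary mult f = cartan_diff mult f"
  by (intro ext coboundary_eq_cartan_diff) (simp_all add: cochains_iff)

lemma coboundary_in_cochains:
  assumes "f \<in> cochains scale n"
  shows "coboundary mult f \<in> cochains scale (Suc n)"
  unfolding coboundary_cochain[OF assms]
  using assms
  by (auto simp: cochains_iff multilinear_cartan_diff alternating_cartan_diff
      intro: cartan_diff_off_degree[of n])

lemma coboundary_coboundary:
  assumes "f \<in> cochains scale n"
  shows "coboundary mult (coboundary mult f) xs = 0"
  unfolding coboundary_cochain[OF coboundary_in_cochains[OF assms]]
  unfolding coboundary_cochain[OF assms]
  using assms by (intro cartan_diff_cartan_diff) (simp add: cochains_iff)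

lemma cochains_zero: "(\<lambda>_. 0) \<in> cochains scale n"
  by (simp add: cochains_iff multilinear_def alternating_def linear_zero)

lemma coboundary_zero: "coboundary mult (\<lambda>_. 0) = (\<lambda>_. 0)"
  by (simp add: coboundary_cochain[OF cochains_zero] cartan_diff_zero fun_eq_iff)

lemma cochains_add:
  "f \<in> cochains scale n \<Longrightarrow> g \<in> cochains scale n \<Longrightarrow> (\<lambda>xs. f xs + g xs) \<in> cochains scale n"
  by (simp add: cochains_iff multilinear_def alternating_def linear_add)

lemma coboundary_add:
  assumes "f \<in> cochains scale n" "g \<in> cochains scale n"
  shows "coboundary mult (\<lambda>xs. f xs + g xs) xs = coboundary mult f xs + coboundary mult g xs"
  by (simp add: coboundary_cochain[OF assms(1)] coboundary_cochain[OF assms(2)]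
      coboundary_cochain[OF cochains_add[OF assms]] cartan_diff_add)

end

section \<open>Compatible products\<close>

context compatible_pre_lie_algebra
begin

abbreviation total :: "'v \<Rightarrow> 'v \<Rightarrow> 'v" where
  "total x y \<equiv> dot x y + ast x y"

text \<open>Left symmetry is quadratic in the product: the pure terms are left symmetry of each
  summand, and the mixed terms are exactly the compatibility condition.\<close>

lemma pre_lie_total: "pre_lie_algebra scale total"
proof (intro pre_lie_algebra.intro pre_lie_algebra_axioms.intro)
  show "vector_space scale" by (rule dot.vector_space_axioms)
  show "Vector_Spaces.linear scale scale (\<lambda>x. total x y)" for y
    by (intro dot.linear_add dot.linear_left ast.linear_left)
  show "Vector_Spaces.linear scale scale (\<lambda>y. total x y)" for x
    by (intro dot.linear_add dot.linear_right ast.linear_right)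
  fix x y z
  have "(total (total x y) z - total x (total y z)) - (total (total y x) z - total y (total x z))
    = ((dot (dot x y) z - dot x (dot y z)) - (dot (dot y x) z - dot y (dot x z)))
      + ((ast (ast x y) z - ast x (ast y z)) - (ast (ast y x) z - ast y (ast x z)))
      + (dot (ast x y) z + ast (dot x y) z - dot x (ast y z) - ast x (dot y z)
      - dot (ast y x) z - ast (dot y x) z + dot y (ast x z) + ast y (dot x z))"
    by (simp add: dot.mult_add_left dot.mult_add_right ast.mult_add_left ast.mult_add_right
        algebra_simps)
  also have "\<dots> = 0"
    unfolding compatible dot.left_symmetric[of x] ast.left_symmetric[of x] by simp
  finally show "total (total x y) z - total x (total y z)
      = total (total y x) z - total y (total x z)" by simp
qed

text \<open>Every term of a Lie derivative contains the product exactly once, and where it sits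
  inside \<open>f\<close> multilinearity splits the sum.\<close>

lemma lie_der_total:
  "multilinear scale f \<Longrightarrow> lie_der total x f zs = lie_der dot x f zs + lie_der ast x f zs"
proof (induction zs arbitrary: f rule: induct_list012)
  case (2 y)
  then show ?case by (simp add: dot.multilinear_plus_head)
next
  case (3 z w zs)
  have "f ((total x z - total z x) # w # zs)
      = f ((dot x z - dot z x) # w # zs) + f ((ast x z - ast z x) # w # zs)"
    by (simp add: dot.multilinear_plus_head[OF 3(3)] dot.multilinear_diff_head[OF 3(3)])
  then show ?case
    using 3(2)[OF multilinear_Cons[OF 3(3)], of z] by simp
qed simp

lemma cartan_diff_total:
  "multilinear scale f \<Longrightarrow>
    cartan_diff total f zs = cartan_diff dot f zs + cartan_diff ast f zs"
  by (induction zs arbitrary: f rule: induct_list012)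
    (simp_all add: lie_der_total multilinear_Cons del: lie_der.simps)

lemma coboundary_anticommute:
  assumes f: "f \<in> cochains scale n"
  shows "coboundary ast (coboundary dot f) xs + coboundary dot (coboundary ast f) xs = 0"
proof -
  interpret total: pre_lie_algebra scale total by (rule pre_lie_total)
  \<comment> \<open>The degree \<open>m\<close> is left free because this is applied to
    \<open>f\<close> and also to its two coboundaries.\<close>
  have split: "coboundary total g xs = coboundary dot g xs + coboundary ast g xs"
    if "g \<in> cochains scale m" for g m xs
    using that dot.cochains_iff[of g m] cartan_diff_total[of g xs]
    by (simp add: total.coboundary_cochain[OF that] dot.coboundary_cochain[OF that]
        ast.coboundary_cochain[OF that])
  note d = dot.coboundary_in_cochains[OF f] and a = ast.coboundary_in_cochains[OF f]
  have "0 = coboundary total (\<lambda>xs. coboundary dot f xs + coboundary ast f xs) xs"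
    using total.coboundary_coboundary[OF f, of xs] by (simp add: split[OF f, abs_def])
  also have "\<dots> = coboundary dot (coboundary ast f) xs + coboundary ast (coboundary dot f) xs"
    unfolding total.coboundary_add[OF d a] split[OF d] split[OF a]
    by (simp add: dot.coboundary_coboundary[OF f] ast.coboundary_coboundary[OF f])
  finally show ?thesis by (simp add: add.commute)
qed

end

section \<open>Tuples of cochains and the square of the compatible coboundary\<close>

text \<open>Extension of the tuple by zero, so that the first, middle and last entries of the
  coboundary obey one formula.\<close>

definition entry :: "('v list \<Rightarrow> 'v::ab_group_add) list \<Rightarrow> nat \<Rightarrow> 'v list \<Rightarrow> 'v" where
  "entry F k = (if k < length F then F ! k else (\<lambda>_. 0))"

text \<open>A case split instead of \<open>k - 1\<close>: truncated subtraction would give the first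
  entry at \<open>k = 0\<close>, where 0 is wanted.\<close>

definition previous_entry :: "('v list \<Rightarrow> 'v::ab_group_add) list \<Rightarrow> nat \<Rightarrow> 'v list \<Rightarrow> 'v" where
  "previous_entry F k = (case k of 0 \<Rightarrow> (\<lambda>_. 0) | Suc j \<Rightarrow> entry F j)"

lemma length_compatible_coboundary:
  "F \<noteq> [] \<Longrightarrow> length (compatible_coboundary dot ast F) = Suc (length F)"
  by (cases F) (auto simp: compatible_coboundary_def neq_Nil_conv not_less_eq_eq)

context compatible_pre_lie_algebra
begin

lemma entry_cochain: "F \<in> compatible_cochains scale n \<Longrightarrow> entry F k \<in> cochains scale n"
  by (auto simp: entry_def compatible_cochains_def dot.cochains_zero)

lemma previous_entry_cochain:
  "F \<in> compatible_cochains scale n \<Longrightarrow> previous_entry F k \<in> cochains scale n"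
  by (auto simp: previous_entry_def dot.cochains_zero entry_cochain split: nat.split)

text \<open>At either end one summand is the coboundary of the zero cochain and drops out; beyond
  the end both do.\<close>

lemma entry_compatible_coboundary:
  assumes "F \<noteq> []"
  shows "entry (compatible_coboundary dot ast F) k
    = (\<lambda>xs. coboundary ast (previous_entry F k) xs + coboundary dot (entry F k) xs)"
proof -
  note zero = dot.coboundary_zero ast.coboundary_zero
  consider "k = 0" | "0 < k" "k < length F" | "k = length F" | "k > length F" by linarith
  then show ?thesis
  proof cases
    case 1
    then show ?thesis using assms
      by (simp add: entry_def previous_entry_def length_compatible_coboundary zero)
        (simp add: compatible_coboundary_def)
  next
    case 2
    then obtain j where "k = Suc j" by (cases k) auto
    then show ?thesis using assms 2
      by (simp add: entry_def previous_entry_def length_compatible_coboundary zero)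
        (simp add: compatible_coboundary_def nth_append less_diff_conv)
  next
    case 3
    then obtain j where "k = Suc j" using assms not0_implies_Suc[of k] by auto
    then show ?thesis using assms 3
      by (simp add: entry_def previous_entry_def length_compatible_coboundary zero)
        (simp add: compatible_coboundary_def nth_append)
  next
    case 4
    then obtain j where "k = Suc j" by (cases k) auto
    then show ?thesis using assms 4
      by (simp add: entry_def previous_entry_def length_compatible_coboundary zero)
  qed
qed

lemma compatible_coboundary_cochain:
  assumes "F \<in> compatible_cochains scale n" "n \<ge> 1"
  shows "compatible_coboundary dot ast F \<in> compatible_cochains scale (n + 1)"
proof -
  let ?G = "compatible_coboundary dot ast F"
  have F: "F \<noteq> []" "length F = n" using assms by (auto simp: compatible_cochains_def)
  have "entry ?G k \<in> cochains scale (Suc n)" for k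
    unfolding entry_compatible_coboundary[OF F(1)]
    by (intro dot.cochains_add dot.coboundary_in_cochains ast.coboundary_in_cochains
        entry_cochain previous_entry_cochain assms)
  then have "?G ! k \<in> cochains scale (Suc n)" if "k < length ?G" for k
    using that by (metis entry_def)
  then show ?thesis
    using F by (auto simp: compatible_cochains_def length_compatible_coboundary in_set_conv_nth)
qed

lemma compatible_coboundary_compatible_coboundary:
  assumes F: "F \<in> compatible_cochains scale n" and n: "n \<ge> 1"
  shows "compatible_coboundary dot ast (compatible_coboundary dot ast F)
    = replicate (n + 2) (\<lambda>_. 0)"
proof -
  let ?G = "compatible_coboundary dot ast F"
  let ?H = "compatible_coboundary dot ast ?G"
  have nonempty: "F \<noteq> []" using assms by (auto simp: compatible_cochains_def)
  have len: "length ?G = n + 1"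
    using compatible_coboundary_cochain[OF assms] by (simp add: compatible_cochains_def)
  then have nonempty': "?G \<noteq> []" by auto
  note e = entry_cochain[OF F] and p = previous_entry_cochain[OF F]
  note d = dot.coboundary_in_cochains and a = ast.coboundary_in_cochains
  \<comment> \<open>The previous entry of \<open>?G\<close> is itself a sum of an \<open>ast\<close>
    and a \<open>dot\<close> coboundary; applying the \<open>ast\<close> coboundary kills the
    former.\<close>
  have prev: "coboundary ast (previous_entry ?G k) xs
      = coboundary ast (coboundary dot (previous_entry F k)) xs" for k xs
  proof (cases k)
    case 0
    then show ?thesis by (simp add: previous_entry_def dot.coboundary_zero)
  next
    case (Suc j)
    then show ?thesis
      by (simp add: previous_entry_def[of ?G] previous_entry_def[of F "Suc j"]
          entry_compatible_coboundary[OF nonempty] ast.coboundary_add[OF a[OF p] d[OF e]]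
          ast.coboundary_coboundary[OF p])
  qed
  \<comment> \<open>What remains is the anticommutator of the two coboundaries on the previous entry
    of \<open>F\<close>, plus the square of the \<open>dot\<close> coboundary on entry
    \<open>k\<close>.\<close>
  have "entry ?H k xs = 0" for k xs
    unfolding entry_compatible_coboundary[OF nonempty'] prev
    unfolding entry_compatible_coboundary[OF nonempty] dot.coboundary_add[OF a[OF p] d[OF e]]
    using coboundary_anticommute[OF p] dot.coboundary_coboundary[OF e] by simp
  then have "?H ! k = (\<lambda>_. 0)" if "k < length ?H" for k
    using that by (metis entry_def ext)
  then show ?thesis
    using length_compatible_coboundary[OF nonempty', of dot ast] len
    by (intro nth_equalityI) (simp_all del: replicate_Suc add_2_eq_Suc')
qed

end

theorem theorem3p1:
  fixes scale :: "'k::field \<Rightarrow> 'v::ab_group_add \<Rightarrow> 'v"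
    and dot ast :: "'v \<Rightarrow> 'v \<Rightarrow> 'v"
    and n :: nat
  assumes "compatible_pre_lie_algebra scale dot ast"
    and "n \<ge> 1"
  shows "(\<forall>F \<in> compatible_cochains scale n.
            compatible_coboundary dot ast F \<in> compatible_cochains scale (n + 1)) \<and>
         (\<forall>F \<in> compatible_cochains scale n.
            compatible_coboundary dot ast (compatible_coboundary dot ast F)
              = replicate (n + 2) (\<lambda>_. 0))"
  using compatible_pre_lie_algebra.compatible_coboundary_cochain[OF assms(1) _ assms(2)]
    compatible_pre_lie_algebra.compatible_coboundary_compatible_coboundary[OF assms(1) _ assms(2)]
  by blast

end
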